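(* For every integer $k\geq 1$ there exist two deterministic context-free languages $L_1,L_2\subseteq \Gamma_k^{*}$, which are in fact deterministic one-counter languages, such that $L(H_k^{sign})=L_1\cap L_2$.
   Context: Alphabet: $\Gamma_k=\{0^{+},0^{-},1^{+},1^{-},\ldots,k^{+},k^{-}\}$. The letter $j^{+}$ has value $j$ and positive polarity; $j^{-}$ has value $j$ and negative polarity. Signed Hammersley process of order $k$, $H_k^{sign}$: start with the empty word $w_0=\lambda$. Given $w_n$, the word $w_{n+1}$ is obtained by inserting, at an arbitrary position of $w_n$, either a letter $k^{+}$ or a letter $k^{-}$, with the following effect. When $k^{-}$ is inserted, the closest letter to its right having positive polarity and nonzero value (i.e. the leftmost letter in $\{1^{+},\ldots,k^{+}\}$ to the right of the insertion), if any exists, has its value decreased by 1 (keeping its polarity). When $k^{+}$ is inserted, the closest letter to its right having negative polarity and nonzero value (in $\{1^{-},\ldots,k^{-}\}$), if any exists, has its value decreased by 1 (keeping its polarity). All other letters are unchanged. $L(H_k^{sign})$ is the set of all words that can be obtained as some $w_n$, $n\geq 0$, over all possible choices. A deterministic one-counter language is a language accepted by a deterministic pushdown automaton whose stack alphabet consists of a single effective symbol together with a bottom-of-stack symbol. *)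

theory Defs
  imports Main
begin

section \<open>The signed Hammersley process\<close>

datatype polarity = Pos | Neg

datatype letter = Letter (val: nat) (pol: polarity)

definition Gam :: "nat \<Rightarrow> letter set" where
  "Gam k = {x. val x \<le> k}"

text \<open>
  \<open>discharge p v\<close> is the effect on the word \<open>v\<close> to the right of a newly inserted letter of
  polarity \<open>p\<close>: the leftmost letter of the opposite polarity with nonzero value, if there
  is one, loses one unit of its value.
\<close>
primrec discharge :: "polarity \<Rightarrow> letter list \<Rightarrow> letter list" where
  "discharge p [] = []"
| "discharge p (x # xs) =
     (if pol x \<noteq> p \<and> val x \<noteq> 0 then Letter (val x - 1) (pol x) # xs
      else x # discharge p xs)"

inductive hammersley_step :: "nat \<Rightarrow> letter list \<Rightarrow> letter list \<Rightarrow> bool" for k where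
  "hammersley_step k (u @ v) (u @ Letter k p # discharge p v)"

definition hammersley_lang :: "nat \<Rightarrow> letter list set" where
  "hammersley_lang k = {w. (hammersley_step k)\<^sup>*\<^sup>* [] w}"

section \<open>Deterministic pushdown automata\<close>

text \<open>
  In \<open>trans M q i X = Some (q', \<alpha>)\<close> the input component \<open>i\<close> is \<open>None\<close> for an
  \<open>\<epsilon>\<close>-move and \<open>Some a\<close> for a move that reads \<open>a\<close>. The move replaces the topmost stack symbol
  \<open>X\<close> by \<open>\<alpha>\<close>; the head of a stack list is its top. The value \<open>None\<close> of \<open>trans\<close> means that
  there is no move.
\<close>
record ('q, 'a, 'g) dpda =
  states :: "'q set"
  input_alphabet :: "'a set"
  stack_alphabet :: "'g set"
  init_state :: 'q
  bottom :: 'g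
  final_states :: "'q set"
  trans :: "'q \<Rightarrow> 'a option \<Rightarrow> 'g \<Rightarrow> ('q \<times> 'g list) option"

text \<open>
  As \<open>trans\<close> is a function, at most one move exists for each state, input component and
  stack symbol. The last conjunct excludes a choice between an \<open>\<epsilon>\<close>-move and a reading move.
\<close>
definition is_dpda :: "('q, 'a, 'g) dpda \<Rightarrow> bool" where
  "is_dpda M \<longleftrightarrow>
     finite (states M) \<and> finite (input_alphabet M) \<and> finite (stack_alphabet M) \<and>
     init_state M \<in> states M \<and> bottom M \<in> stack_alphabet M \<and>
     final_states M \<subseteq> states M \<and>
     (\<forall>q\<in>states M. \<forall>i. \<forall>X\<in>stack_alphabet M. \<forall>q' \<alpha>.
        set_option i \<subseteq> input_alphabet M \<and> trans M q i X = Some (q', \<alpha>) \<longrightarrow>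
        q' \<in> states M \<and> set \<alpha> \<subseteq> stack_alphabet M) \<and>
     (\<forall>q\<in>states M. \<forall>X\<in>stack_alphabet M.
        trans M q None X \<noteq> None \<longrightarrow> (\<forall>a\<in>input_alphabet M. trans M q (Some a) X = None))"

inductive dpda_step ::
  "('q, 'a, 'g) dpda \<Rightarrow> 'q \<times> 'a list \<times> 'g list \<Rightarrow> 'q \<times> 'a list \<times> 'g list \<Rightarrow> bool" for M where
  eps: "trans M q None X = Some (q', \<alpha>) \<Longrightarrow> dpda_step M (q, w, X # \<gamma>) (q', w, \<alpha> @ \<gamma>)"
| read: "trans M q (Some a) X = Some (q', \<alpha>) \<Longrightarrow> dpda_step M (q, a # w, X # \<gamma>) (q', w, \<alpha> @ \<gamma>)"

text \<open>Acceptance is by final state, with arbitrary final stack contents.\<close>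
definition dpda_lang :: "('q, 'a, 'g) dpda \<Rightarrow> 'a list set" where
  "dpda_lang M =
     {w \<in> lists (input_alphabet M). \<exists>q\<in>final_states M. \<exists>\<gamma>.
        (dpda_step M)\<^sup>*\<^sup>* (init_state M, w, [bottom M]) (q, [], \<gamma>)}"

text \<open>
  States and stack symbols are drawn from \<open>nat\<close>. This is no restriction: the sets in use are
  finite, so they can always be renamed.
\<close>
definition deterministic_cfl :: "'a set \<Rightarrow> 'a list set \<Rightarrow> bool" where
  "deterministic_cfl \<Sigma> L \<longleftrightarrow>
     (\<exists>M :: (nat, 'a, nat) dpda. is_dpda M \<and> input_alphabet M = \<Sigma> \<and> dpda_lang M = L)"

text \<open>
  The stack alphabet consists of one counter symbol and the bottom marker. The marker
  stays at the bottom of the stack: it is neither removed nor pushed a second time, so a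
  stack is determined by the number of counter symbols above the marker.
\<close>
definition one_counter :: "('q, 'a, 'g) dpda \<Rightarrow> bool" where
  "one_counter M \<longleftrightarrow>
     (\<exists>A. A \<noteq> bottom M \<and> stack_alphabet M = {A, bottom M} \<and>
        (\<forall>q\<in>states M. \<forall>i q' \<alpha>. set_option i \<subseteq> input_alphabet M \<longrightarrow>
           (trans M q i A = Some (q', \<alpha>) \<longrightarrow> bottom M \<notin> set \<alpha>) \<and>
           (trans M q i (bottom M) = Some (q', \<alpha>) \<longrightarrow>
              (\<exists>\<beta>. \<alpha> = \<beta> @ [bottom M] \<and> bottom M \<notin> set \<beta>))))"

definition deterministic_one_counter_language :: "'a set \<Rightarrow> 'a list set \<Rightarrow> bool" where
  "deterministic_one_counter_language \<Sigma> L \<longleftrightarrow>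
     (\<exists>M :: (nat, 'a, nat) dpda.
        is_dpda M \<and> one_counter M \<and> input_alphabet M = \<Sigma> \<and> dpda_lang M = L)"

end

(* Call a word covered with respect to a polarity p if, in every prefix, the letters of the opposite
   polarity have together lost at most as many units as there are letters of polarity p. Every lost
   unit is taken by a letter of polarity p further to the left, so reachable words are covered for
   both polarities. Conversely, in a nonempty word that is covered for both polarities the first
   letter has value k, so there is a last letter of value k. Deleting it and returning one unit to
   the first letter of opposite polarity behind it undoes a step of the process and preserves both
   conditions. Each condition compares one counter with zero, which a deterministic one-counter
   automaton does. *)
theory Submission
  imports Defs
begin

text \<open>The number \<open>n\<close> is the surplus of letters of polarity \<open>p\<close> accumulated to the left.\<close>
primrec covered :: "nat \<Rightarrow> polarity \<Rightarrow> nat \<Rightarrow> letter list \<Rightarrow> bool" where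
  "covered k p n [] \<longleftrightarrow> True"
| "covered k p n (x # xs) \<longleftrightarrow>
     (if pol x = p then covered k p (Suc n) xs
      else k - val x \<le> n \<and> covered k p (n - (k - val x)) xs)"

definition covered_lang :: "nat \<Rightarrow> polarity \<Rightarrow> letter list set" where
  "covered_lang k p = {w \<in> lists (Gam k). covered k p 0 w}"

lemma polarity_neq_trans: "p \<noteq> q \<Longrightarrow> q \<noteq> r \<Longrightarrow> p = (r :: polarity)"
  by (cases p; cases q; cases r) auto

text \<open>Reading \<open>u\<close> turns \<open>n\<close> into a surplus that does not depend on
  what follows. As its value is not known, the assumption is made for all \<open>n\<close>.\<close>

lemma covered_append_mono:
  assumes "\<And>n. covered k p n v \<Longrightarrow> covered k p n v'"
  shows "covered k p n (u @ v) \<Longrightarrow> covered k p n (u @ v')"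
  using assms by (induction u arbitrary: n) auto

section \<open>The process preserves coverage\<close>

lemma discharge_in_lists: "v \<in> lists (Gam k) \<Longrightarrow> discharge p v \<in> lists (Gam k)"
  by (induction v) (auto simp: Gam_def)

text \<open>The discharged unit is paid for by the inserted letter: the surplus is one higher up to
  the discharged letter and equal to the old one after it. If no letter is discharged, it just stays
  higher.\<close>

lemma covered_discharge_same:
  "v \<in> lists (Gam k) \<Longrightarrow> covered k p n v \<Longrightarrow> covered k p (Suc n) (discharge p v)"
proof (induction v arbitrary: n)
  case (Cons x xs)
  then have le: "val x \<le> k" and xs: "xs \<in> lists (Gam k)"
    by (auto simp: Gam_def)
  consider "pol x = p" | "pol x \<noteq> p" "val x = 0" | "pol x \<noteq> p" "val x \<noteq> 0"
    by blast
  then show ?case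
  proof cases
    case 1
    then show ?thesis using Cons.IH[OF xs] Cons.prems by simp
  next
    case 2
    \<comment> \<open>A letter of value 0 costs \<open>k\<close>. Coverage gives
      \<open>k \<le> n\<close>, so truncated subtraction keeps the extra unit:
      \<open>Suc n - k = Suc (n - k)\<close>.\<close>
    then show ?thesis using Cons.IH[OF xs, of "n - k"] Cons.prems by (simp add: Suc_diff_le)
  next
    case 3
    then have "k - (val x - 1) = Suc (k - val x)" using le by simp
    then show ?thesis using 3 Cons.prems by simp
  qed
qed simp

text \<open>Only a letter of polarity \<open>p\<close> can change here, and \<open>covered\<close>
  ignores the values of such letters.\<close>

lemma covered_discharge_other: "r \<noteq> p \<Longrightarrow> covered k p n (discharge r v) = covered k p n v"
proof (induction v arbitrary: n)
  case (Cons x xs)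
  show ?case
  proof (cases "pol x = r")
    case False
    then have "pol x = p" using Cons.prems by (rule polarity_neq_trans)
    then show ?thesis using Cons by simp
  qed (use Cons in simp)
qed simp

lemma covered_insert:
  assumes "v \<in> lists (Gam k)" "covered k p n v"
  shows "covered k p n (Letter k r # discharge r v)"
  using assms covered_discharge_same[OF assms] by (cases "r = p") (simp_all add: covered_discharge_other)

lemma covered_lang_step:
  assumes "hammersley_step k w w'" "w \<in> covered_lang k p"
  shows "w' \<in> covered_lang k p"
  using assms(1)
proof cases
  case (1 u v r)
  then have v: "v \<in> lists (Gam k)" and u: "u \<in> lists (Gam k)"
    using assms(2) by (auto simp: covered_lang_def)
  have "covered k p 0 w'"
    unfolding 1
    by (rule covered_append_mono[OF covered_insert[OF v]])
      (use assms(2) 1 in \<open>auto simp: covered_lang_def\<close>)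
  then show ?thesis
    using discharge_in_lists[OF v] u 1 by (auto simp: covered_lang_def Gam_def)
qed

lemma hammersley_lang_subset: "hammersley_lang k \<subseteq> covered_lang k p"
proof
  fix w assume "w \<in> hammersley_lang k"
  then have "(hammersley_step k)\<^sup>*\<^sup>* [] w" by (simp add: hammersley_lang_def)
  then show "w \<in> covered_lang k p"
    by (induction rule: rtranclp_induct) (auto simp: covered_lang_def dest: covered_lang_step[unfolded covered_lang_def])
qed

section \<open>Every word covered for both polarities is reachable\<close>

text \<open>Of the possible preimages under \<open>discharge p\<close>, this one returns the unit as
  early as possible, even to a letter of value 0.\<close>

primrec charge :: "polarity \<Rightarrow> letter list \<Rightarrow> letter list" where
  "charge p [] = []"
| "charge p (x # xs) =
     (if pol x \<noteq> p then Letter (Suc (val x)) (pol x) # xs else x # charge p xs)"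

lemma discharge_charge [simp]: "discharge p (charge p v) = v"
  by (induction v) auto

lemma length_charge [simp]: "length (charge p v) = length v"
  by (induction v) auto

lemma charge_in_lists: "\<forall>x\<in>set v. val x < k \<Longrightarrow> charge p v \<in> lists (Gam k)"
proof (induction v)
  case (Cons x xs)
  then have "xs \<in> lists (Gam k)" by (force simp: Gam_def)
  with Cons show ?case by (auto simp: Gam_def)
qed simp

text \<open>Only letters of polarity \<open>p\<close> precede the charged letter, so a surplus
  smaller by one does no harm there. The charged letter has value below \<open>k\<close>, hence its
  cost falls by one and makes up for the difference.\<close>

lemma covered_charge_same:
  "\<forall>x\<in>set v. val x < k \<Longrightarrow> covered k p (Suc n) v \<Longrightarrow> covered k p n (charge p v)"
proof (induction v arbitrary: n)
  case (Cons x xs)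
  show ?case
  proof (cases "pol x = p")
    case False
    have "k - val x = Suc (k - Suc (val x))" using Cons.prems(1) by (simp add: Suc_diff_Suc)
    then show ?thesis using False Cons.prems(2) by simp
  qed (use Cons in auto)
qed simp

lemma covered_charge_other: "r \<noteq> p \<Longrightarrow> covered k p n (charge r v) = covered k p n v"
proof (induction v arbitrary: n)
  case (Cons x xs)
  show ?case
  proof (cases "pol x = r")
    case False
    then have "pol x = p" using Cons.prems by (rule polarity_neq_trans)
    then show ?thesis using Cons by simp
  qed (use Cons in simp)
qed simp

lemma covered_delete:
  assumes "\<forall>y\<in>set v. val y < k" "covered k p n (Letter k r # v)"
  shows "covered k p n (charge r v)"
  using assms covered_charge_same[OF assms(1), of p n] by (cases "r = p") (simp_all add: covered_charge_other)

text \<open>Under the polarity opposite to that of \<open>x\<close>, the first letter meets surplus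
  0 and so can have lost nothing.\<close>

lemma covered_hd_val:
  assumes "x # xs \<in> covered_lang k Pos \<inter> covered_lang k Neg"
  shows "val x = k"
  using assms by (cases "pol x") (auto simp: covered_lang_def Gam_def)

lemma covered_imp_hammersley:
  "w \<in> covered_lang k Pos \<inter> covered_lang k Neg \<Longrightarrow> w \<in> hammersley_lang k"
proof (induction w rule: length_induct)
  case (1 w)
  show ?case
  proof (cases w)
    case Nil
    then show ?thesis by (simp add: hammersley_lang_def)
  next
    case (Cons y ys)
    then have "\<exists>x\<in>set w. val x = k" using covered_hd_val 1(2) by force
    \<comment> \<open>Taking the last such letter leaves only values below \<open>k\<close> in
      \<open>v\<close>, so that charging cannot leave the alphabet.\<close>
    then obtain u x v where w: "w = u @ x # v" "val x = k" and "\<forall>y\<in>set v. val y \<noteq> k"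
      using split_list_last_prop[of w "\<lambda>x. val x = k"] by metis
    define r where "r = pol x"
    have x: "x = Letter k r" using w(2) r_def by (cases x) auto
    have "w \<in> lists (Gam k)" using 1(2) by (auto simp: covered_lang_def)
    then have u: "u \<in> lists (Gam k)" and "v \<in> lists (Gam k)" using w by auto
    then have v: "\<forall>y\<in>set v. val y < k"
      using \<open>\<forall>y\<in>set v. val y \<noteq> k\<close> by (force simp: Gam_def)
    let ?w = "u @ charge r v"
    have cov: "covered k p 0 ?w" if "covered k p 0 w" for p
      by (rule covered_append_mono[OF covered_delete[OF v]]) (use that w x in auto)
    have "?w \<in> covered_lang k Pos \<inter> covered_lang k Neg"
      using 1(2) cov u charge_in_lists[OF v] by (auto simp: covered_lang_def)
    then have "?w \<in> hammersley_lang k" using 1(1) w by simp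
    moreover have "hammersley_step k ?w w"
      using hammersley_step.intros[of k u "charge r v" r] w x by simp
    ultimately show ?thesis
      by (auto simp: hammersley_lang_def intro: rtranclp.rtrancl_into_rtrancl)
  qed
qed

lemma hammersley_lang_eq: "hammersley_lang k = covered_lang k Pos \<inter> covered_lang k Neg"
  using hammersley_lang_subset covered_imp_hammersley by blast

section \<open>The automata\<close>

text \<open>The stack holds the surplus in unary (counter symbol 1 above the bottom marker 0). The state is
  the number of units still to be popped; in a positive state facing the marker the automaton
  is stuck.\<close>
definition cover_dpda :: "nat \<Rightarrow> polarity \<Rightarrow> (nat, letter, nat) dpda" where
  "cover_dpda k p =
    \<lparr>states = {..k}, input_alphabet = Gam k, stack_alphabet = {1, 0},
     init_state = 0, bottom = 0, final_states = {0},
     trans = (\<lambda>q i X. case i of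
         None \<Rightarrow> if 0 < q \<and> X = 1 then Some (q - 1, []) else None
       | Some x \<Rightarrow> if q = 0 then Some (if pol x = p then (0, [1, X]) else (k - val x, [X]))
           else None)\<rparr>"

lemma finite_Gam: "finite (Gam k)"
proof -
  have "Gam k \<subseteq> (\<lambda>(v, p). Letter v p) ` ({..k} \<times> {Pos, Neg})"
  proof
    fix x assume "x \<in> Gam k"
    then show "x \<in> (\<lambda>(v, p). Letter v p) ` ({..k} \<times> {Pos, Neg})"
      by (cases x; cases "pol x") (auto simp: Gam_def image_iff)
  qed
  then show ?thesis by (rule finite_subset) simp
qed

lemma is_dpda_cover: "is_dpda (cover_dpda k p)"
  by (auto simp: is_dpda_def cover_dpda_def finite_Gam split: option.splits if_splits)

lemma one_counter_cover: "one_counter (cover_dpda k p)"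
  unfolding one_counter_def
  by (rule exI[of _ 1]) (auto simp: cover_dpda_def split: option.splits if_splits)

abbreviation counter_stack :: "nat \<Rightarrow> nat list" where
  "counter_stack n \<equiv> replicate n 1 @ [0]"

lemma cover_dpda_step_eps:
  "dpda_step (cover_dpda k p) (Suc q, w, counter_stack (Suc n)) (q, w, counter_stack n)"
  using dpda_step.eps[of "cover_dpda k p" "Suc q" 1 q "[]" w "counter_stack n"]
  by (simp add: cover_dpda_def)

lemma cover_dpda_step_push:
  assumes "pol x = p"
  shows "dpda_step (cover_dpda k p) (0, x # w, counter_stack n) (0, w, counter_stack (Suc n))"
proof -
  \<comment> \<open>The top \<open>X\<close> is the marker or a counter symbol; reading moves treat
    both alike.\<close>
  obtain X \<gamma> where X: "counter_stack n = X # \<gamma>" by (cases "counter_stack n") auto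
  then show ?thesis
    using assms dpda_step.read[of "cover_dpda k p" 0 x X 0 "[1, X]" w \<gamma>]
    by (simp add: cover_dpda_def)
qed

lemma cover_dpda_step_read:
  assumes "pol x \<noteq> p"
  shows "dpda_step (cover_dpda k p) (0, x # w, counter_stack n) (k - val x, w, counter_stack n)"
proof -
  obtain X \<gamma> where X: "counter_stack n = X # \<gamma>" by (cases "counter_stack n") auto
  then show ?thesis
    using assms dpda_step.read[of "cover_dpda k p" 0 x X "k - val x" "[X]" w \<gamma>]
    by (simp add: cover_dpda_def)
qed

lemma cover_dpda_pop:
  "q \<le> n \<Longrightarrow>
   (dpda_step (cover_dpda k p))\<^sup>*\<^sup>* (q, w, counter_stack n) (0, w, counter_stack (n - q))"
proof (induction q arbitrary: n)
  case (Suc q)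
  then obtain m where "n = Suc m" "q \<le> m" by (cases n) auto
  then show ?case
    using converse_rtranclp_into_rtranclp[OF cover_dpda_step_eps Suc.IH] by simp
qed simp

lemma covered_imp_accepted:
  "covered k p n w \<Longrightarrow>
   \<exists>\<gamma>. (dpda_step (cover_dpda k p))\<^sup>*\<^sup>* (0, w, counter_stack n) (0, [], \<gamma>)"
proof (induction w arbitrary: n)
  case (Cons x xs)
  show ?case
  proof (cases "pol x = p")
    case True
    with Cons.prems have "covered k p (Suc n) xs" by simp
    from Cons.IH[OF this] cover_dpda_step_push[OF True]
    show ?thesis by (meson converse_rtranclp_into_rtranclp)
  next
    case False
    let ?d = "k - val x"
    from False Cons.prems have d: "?d \<le> n" "covered k p (n - ?d) xs" by auto
    from Cons.IH[OF d(2)] obtain \<gamma> where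
      "(dpda_step (cover_dpda k p))\<^sup>*\<^sup>* (0, xs, counter_stack (n - ?d)) (0, [], \<gamma>)" by blast
    with cover_dpda_pop[OF d(1)] cover_dpda_step_read[OF False]
    show ?thesis by (meson converse_rtranclp_into_rtranclp rtranclp_trans)
  qed
qed auto

text \<open>A positive state facing the marker is stuck, so returning to state 0 forces
  \<open>q \<le> n\<close>. A general \<open>q\<close> is needed because the induction passes
  through configurations with pops still pending.\<close>

lemma accepted_imp_covered:
  "(dpda_step (cover_dpda k p))\<^sup>*\<^sup>* (q, w, counter_stack n) (0, [], \<gamma>) \<Longrightarrow>
   q \<le> n \<and> covered k p (n - q) w"
proof (induction "(q, w, counter_stack n)" arbitrary: q w n rule: converse_rtranclp_induct)
  case (step c)
  from step.hyps(1) show ?case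
  proof cases
    case (eps X q' \<alpha> \<gamma>')
    then have "0 < q" "X = 1" "q' = q - 1" "\<alpha> = []"
      by (auto simp: cover_dpda_def split: if_splits)
    moreover obtain m where "n = Suc m" "\<gamma>' = counter_stack m"
      using eps \<open>X = 1\<close> by (cases n) auto
    ultimately show ?thesis using step.hyps(3)[of "q - 1" w m] eps by auto
  next
    case (read x X q' \<alpha> w' \<gamma>')
    then have "q = 0" by (auto simp: cover_dpda_def split: if_splits)
    show ?thesis
    proof (cases "pol x = p")
      case True
      then have "c = (0, w', counter_stack (Suc n))"
        using read by (auto simp: cover_dpda_def split: if_splits)
      then show ?thesis using step.hyps(3) read True \<open>q = 0\<close> by fastforce
    next
      case False
      then have "c = (k - val x, w', counter_stack n)"
        using read by (auto simp: cover_dpda_def split: if_splits)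
      then show ?thesis using step.hyps(3) read False \<open>q = 0\<close> by fastforce
    qed
  qed
qed simp

lemma dpda_lang_cover: "dpda_lang (cover_dpda k p) = covered_lang k p"
proof -
  have "(\<exists>\<gamma>. (dpda_step (cover_dpda k p))\<^sup>*\<^sup>* (0, w, [0]) (0, [], \<gamma>)) \<longleftrightarrow> covered k p 0 w" for w
    using covered_imp_accepted[of k p 0 w] accepted_imp_covered[of k p 0 w 0] by auto
  then show ?thesis
    by (simp add: dpda_lang_def covered_lang_def) (simp add: cover_dpda_def)
qed

lemma covered_lang_one_counter: "deterministic_one_counter_language (Gam k) (covered_lang k p)"
  unfolding deterministic_one_counter_language_def
  using is_dpda_cover one_counter_cover dpda_lang_cover
  by (intro exI[of _ "cover_dpda k p"]) (auto simp: cover_dpda_def)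

lemma one_counter_imp_cfl: "deterministic_one_counter_language \<Sigma> L \<Longrightarrow> deterministic_cfl \<Sigma> L"
  by (auto simp: deterministic_one_counter_language_def deterministic_cfl_def)

theorem corollary3:
  fixes k :: nat
  assumes "k \<ge> 1"
  shows "\<exists>L1 L2.
    L1 \<subseteq> lists (Gam k) \<and> L2 \<subseteq> lists (Gam k) \<and>
    deterministic_cfl (Gam k) L1 \<and> deterministic_cfl (Gam k) L2 \<and>
    deterministic_one_counter_language (Gam k) L1 \<and>
    deterministic_one_counter_language (Gam k) L2 \<and>
    hammersley_lang k = L1 \<inter> L2"
proof (intro exI conjI)
  show "hammersley_lang k = covered_lang k Pos \<inter> covered_lang k Neg"
    by (rule hammersley_lang_eq)
qed (auto simp: covered_lang_def[of k] intro!: covered_lang_one_counter[unfolded covered_lang_def]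
    one_counter_imp_cfl)

end
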